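(* Let $T\in\mathbb{C}^{m\times n}$ be a partial isometry and let $A\in\mathbb{C}^{m\times n}$. Then the following are equivalent: (i) $A$ is $T$-EP; (ii) $A^*$ is $T^*$-EP; (iii) $A^\dagger$ is $T^*$-EP.
   Context: $\mathcal{R}(\cdot)$ denotes the range space, $^*$ the conjugate transpose, and $A^\dagger$ the Moore-Penrose inverse of $A$. A matrix $S$ is a partial isometry if $S=SS^*S$ (so $T^*$ is a partial isometry whenever $T$ is). For a partial isometry $S\in\mathbb{C}^{p\times q}$ and $B\in\mathbb{C}^{p\times q}$, $B$ is $S$-EP if $\mathcal{R}(B)=\mathcal{R}(SB^*S)$ and $B=BS^*S$. *)

theory Defs
  imports "HOL-Analysis.Analysis"
begin

text \<open>
  A matrix in \<open>\<complex>\<^bsup>m\<times>n\<^esup>\<close> is an element of \<^typ>\<open>complex^'n^'m\<close> (row index last in the type).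
\<close>

definition conj_transpose :: "complex^'n^'m \<Rightarrow> complex^'m^'n"
  where "conj_transpose A = (\<chi> i j. cnj (A $ j $ i))"

definition range_space :: "complex^'n^'m \<Rightarrow> (complex^'m) set"
  where "range_space A = range (\<lambda>x. A *v x)"

definition is_moore_penrose :: "complex^'n^'m \<Rightarrow> complex^'m^'n \<Rightarrow> bool"
  where "is_moore_penrose A X \<longleftrightarrow>
    A ** X ** A = A \<and>
    X ** A ** X = X \<and>
    conj_transpose (A ** X) = A ** X \<and>
    conj_transpose (X ** A) = X ** A"

text \<open>
  Every complex matrix has exactly one Moore--Penrose inverse, so the description below is
  always proper.
\<close>

definition moore_penrose :: "complex^'n^'m \<Rightarrow> complex^'m^'n"
  where "moore_penrose A = (THE X. is_moore_penrose A X)"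

definition partial_isometry :: "complex^'n^'m \<Rightarrow> bool"
  where "partial_isometry S \<longleftrightarrow> S = S ** conj_transpose S ** S"

text \<open>
  \<open>S_EP S B\<close> says that \<open>B\<close> is \<open>S\<close>-EP. The notion is meant for partial isometries \<open>S\<close> only;
  that requirement is not part of the definition and has to be assumed where it is used.
\<close>

definition S_EP :: "complex^'n^'m \<Rightarrow> complex^'n^'m \<Rightarrow> bool"
  where "S_EP S B \<longleftrightarrow>
    range_space B = range_space (S ** conj_transpose B ** S) \<and>
    B = B ** conj_transpose S ** S"

end

theory Submission
  imports Defs
begin

text \<open>
  Write \<open>R\<close> for the range space and \<open>S\<^sup>*\<close> for the conjugate transpose. Being \<open>S\<close>-EP turns out to be
  a property of the pair of subspaces \<open>R(B)\<close> and \<open>R(B\<^sup>*)\<close> alone. For a partial isometry \<open>S\<close>, the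
  products \<open>S S\<^sup>*\<close> and \<open>S\<^sup>* S\<close> are the orthogonal projections onto \<open>R(S)\<close> and \<open>R(S\<^sup>*)\<close>, so the
  equation \<open>B = B S\<^sup>* S\<close> says \<open>R(B\<^sup>*) \<subseteq> R(S\<^sup>*)\<close>. The range equation forces \<open>R(B) \<subseteq> R(S)\<close>, hence
  \<open>B\<^sup>* = B\<^sup>* S S\<^sup>*\<close>; this makes \<open>R(B\<^sup>* S) = R(B\<^sup>*)\<close>, and the range equation becomes
  \<open>S R(B\<^sup>*) = R(B)\<close>. This is lemma \<open>S_EP_iff_range_spaces\<close>.

  Both equivalences follow. Passing from \<open>(T, A)\<close> to \<open>(T\<^sup>*, A\<^sup>*)\<close> exchanges the two inclusions and
  replaces \<open>T R(A\<^sup>*) = R(A)\<close> by \<open>T\<^sup>* R(A) = R(A\<^sup>*)\<close>, which is the same condition because \<open>T\<close> and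
  \<open>T\<^sup>*\<close> are mutually inverse between \<open>R(T\<^sup>*)\<close> and \<open>R(T)\<close>. Passing from \<open>A\<^sup>*\<close> to the Moore--Penrose
  inverse \<open>X\<close> of \<open>A\<close> changes nothing, because \<open>R(X) = R(A\<^sup>*)\<close> and \<open>R(X\<^sup>*) = R(A)\<close>.

  Since the Moore--Penrose inverse is given by a definite description, its existence and uniqueness
  have to be established. Existence uses Zlobec's formula \<open>X = A\<^sup>* G A\<^sup>*\<close>, where \<open>G\<close> is any solution
  of \<open>C G C = C\<close> for \<open>C = A\<^sup>* A A\<^sup>*\<close>.
\<close>

section \<open>The conjugate transpose\<close>

lemma conj_transpose_conj_transpose [simp]: "conj_transpose (conj_transpose A) = A"
  by (simp add: conj_transpose_def vec_eq_iff)

lemma conj_transpose_mult: "conj_transpose (A ** B) = conj_transpose B ** conj_transpose A"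
  by (simp add: conj_transpose_def matrix_matrix_mult_def vec_eq_iff mult.commute)

lemma conj_transpose_eq_iff: "conj_transpose A = conj_transpose B \<longleftrightarrow> A = B"
  using conj_transpose_conj_transpose by metis

text \<open>
  The \<open>j\<close>-th diagonal entry of \<open>A\<^sup>* A\<close> is the squared norm of the \<open>j\<close>-th column of \<open>A\<close>.
\<close>

lemma conj_transpose_mult_self_eq_0:
  fixes A :: "complex^'n^'m"
  assumes "conj_transpose A ** A = 0"
  shows "A = 0"
proof -
  have "A $ i $ j = 0" for i j
  proof -
    have "(\<Sum>k\<in>UNIV. complex_of_real ((cmod (A $ k $ j))\<^sup>2)) = (conj_transpose A ** A) $ j $ j"
      unfolding complex_norm_square
      by (simp add: conj_transpose_def matrix_matrix_mult_def mult.commute)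
    also have "\<dots> = 0"
      by (simp add: assms)
    finally have "(\<Sum>k\<in>UNIV. (cmod (A $ k $ j))\<^sup>2) = 0"
      by (metis of_real_eq_0_iff of_real_sum)
    then show ?thesis
      by (simp add: sum_nonneg_eq_0_iff)
  qed
  then show ?thesis
    by (simp add: vec_eq_iff)
qed

lemma matrix_diff_ldistrib: "A ** (B - C) = A ** B - A ** (C :: 'a::ring_1^'p^'n)"
  by (simp add: matrix_matrix_mult_def vec_eq_iff right_diff_distrib sum_subtractf)

text \<open>
  A left factor \<open>A\<^sup>*\<close> in front of \<open>A\<close> can be cancelled since \<open>A\<^sup>* A\<close> and \<open>A\<close> have the same kernel:
  with \<open>D = B - C\<close>, the equation \<open>A\<^sup>* A D = 0\<close> gives \<open>(A D)\<^sup>* (A D) = 0\<close>.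
\<close>

lemma gram_cancel_left:
  fixes A :: "complex^'n^'m" and B C :: "complex^'p^'n"
  assumes "conj_transpose A ** A ** B = conj_transpose A ** A ** C"
  shows "A ** B = A ** C"
proof -
  have "conj_transpose A ** (A ** (B - C)) = 0"
    using assms by (simp add: matrix_mul_assoc matrix_diff_ldistrib)
  then have "conj_transpose (A ** (B - C)) ** (A ** (B - C)) = 0"
    by (simp add: conj_transpose_mult flip: matrix_mul_assoc)
  then have "A ** (B - C) = 0"
    by (rule conj_transpose_mult_self_eq_0)
  then show ?thesis
    by (simp add: matrix_diff_ldistrib)
qed

lemma gram_cancel_right:
  fixes A :: "complex^'n^'m" and B C :: "complex^'m^'p"
  assumes "B ** A ** conj_transpose A = C ** A ** conj_transpose A"
  shows "B ** A = C ** A"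
proof -
  from arg_cong[OF assms, of conj_transpose]
  have "conj_transpose (conj_transpose A) ** conj_transpose A ** conj_transpose B =
      conj_transpose (conj_transpose A) ** conj_transpose A ** conj_transpose C"
    by (simp add: conj_transpose_mult matrix_mul_assoc)
  then have "conj_transpose A ** conj_transpose B = conj_transpose A ** conj_transpose C"
    by (rule gram_cancel_left)
  then have "conj_transpose (B ** A) = conj_transpose (C ** A)"
    by (simp add: conj_transpose_mult)
  then show ?thesis
    by (simp add: conj_transpose_eq_iff)
qed

lemma hermitian_if_eq_mult_conj_transpose:
  assumes "H = H ** conj_transpose H"
  shows "conj_transpose H = H"
proof -
  have "conj_transpose H = conj_transpose (H ** conj_transpose H)"
    by (rule arg_cong[OF assms])
  also have "\<dots> = H ** conj_transpose H"
    by (simp add: conj_transpose_mult)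
  also have "\<dots> = H"
    by (rule assms[symmetric])
  finally show ?thesis .
qed

section \<open>The Moore--Penrose inverse\<close>

text \<open>
  A linear map has a linear right inverse on its range, and the matrix of such a map can serve
  as \<open>G\<close>.
\<close>

lemma exists_generalized_inverse:
  fixes A :: "'a::field^'n^'m"
  shows "\<exists>G. A ** G ** A = A"
proof -
  have "Vector_Spaces.linear (*s) (*s) ((*v) A)"
    by (rule matrix_vector_mul_linear_gen)
  from vec.linear_exists_right_inverse_on[OF this vec.subspace_UNIV]
  obtain g where g: "Vector_Spaces.linear (*s) (*s) g" and inv: "\<And>x. A *v g (A *v x) = A *v x"
    by auto
  have "A *v (matrix g *v (A *v x)) = A *v x" for x
    using inv by (simp add: matrix_works[OF g])
  then have "A ** matrix g ** A = A"
    by (simp add: matrix_eq flip: matrix_vector_mul_assoc)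
  then show ?thesis ..
qed

text \<open>
  The matrix \<open>C = A\<^sup>* A A\<^sup>*\<close> is chosen so that \<open>C G C = C\<close> can be reduced by the cancellation rules on
  either side. For \<open>X = A\<^sup>* G A\<^sup>*\<close>, cancelling twice on the left leaves \<open>X A A\<^sup>* = A\<^sup>*\<close>, and cancelling
  twice on the right leaves \<open>A\<^sup>* A X = A\<^sup>*\<close>. The first makes \<open>X A\<close> Hermitian, the second
  makes \<open>A X\<close> Hermitian; \<open>A X A = A\<close> is then the adjoint of the first, and \<open>X A X = X\<close> is the first
  multiplied by \<open>G A\<^sup>*\<close>.
\<close>

lemma exists_moore_penrose:
  fixes A :: "complex^'n^'m"
  shows "\<exists>X. is_moore_penrose A X"
proof -
  let ?B = "conj_transpose A"
  obtain G where G: "(?B ** A ** ?B) ** G ** (?B ** A ** ?B) = ?B ** A ** ?B"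
    using exists_generalized_inverse by blast
  define X where "X = ?B ** G ** ?B"
  have "A ** (?B ** G ** ?B ** A ** ?B) = A ** ?B"
    by (rule gram_cancel_left) (use G in \<open>simp add: matrix_mul_assoc\<close>)
  then have "conj_transpose ?B ** ?B ** (G ** ?B ** A ** ?B) = conj_transpose ?B ** ?B ** mat 1"
    by (simp add: matrix_mul_assoc)
  from gram_cancel_left[OF this] have XAB: "X ** A ** ?B = ?B"
    by (simp add: X_def matrix_mul_assoc)
  have "(?B ** A ** ?B ** G ** ?B) ** A = ?B ** A"
    by (rule gram_cancel_right) (use G in \<open>simp add: matrix_mul_assoc\<close>)
  then have "(?B ** A ** ?B ** G) ** ?B ** conj_transpose ?B = mat 1 ** ?B ** conj_transpose ?B"
    by (simp add: matrix_mul_assoc)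
  from gram_cancel_right[OF this] have BAX: "?B ** A ** X = ?B"
    by (simp add: X_def matrix_mul_assoc)
  have AXA': "A ** conj_transpose (X ** A) = A"
    using arg_cong[OF XAB, of conj_transpose] by (simp add: conj_transpose_mult)
  then have "X ** A = X ** A ** conj_transpose (X ** A)"
    by (simp flip: matrix_mul_assoc)
  then have herm_XA: "conj_transpose (X ** A) = X ** A"
    by (rule hermitian_if_eq_mult_conj_transpose)
  have "conj_transpose X ** (?B ** A ** X) = conj_transpose X ** ?B"
    by (simp only: BAX)
  then have "conj_transpose (A ** X) = conj_transpose (A ** X) ** conj_transpose (conj_transpose (A ** X))"
    by (simp add: conj_transpose_mult matrix_mul_assoc)
  from hermitian_if_eq_mult_conj_transpose[OF this]
  have herm_AX: "conj_transpose (A ** X) = A ** X"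
    by simp
  have "A ** X ** A = A"
    using AXA' herm_XA by (simp add: matrix_mul_assoc)
  moreover have "X ** A ** X = X"
    using XAB by (simp add: X_def matrix_mul_assoc)
  ultimately show ?thesis
    using herm_XA herm_AX unfolding is_moore_penrose_def by blast
qed

lemma is_moore_penrose_conj_transpose:
  assumes "is_moore_penrose A X"
  shows "is_moore_penrose (conj_transpose A) (conj_transpose X)"
proof -
  have AX: "conj_transpose X ** conj_transpose A = A ** X"
    and XA: "conj_transpose A ** conj_transpose X = X ** A"
    using assms unfolding is_moore_penrose_def conj_transpose_mult[symmetric] by blast+
  have "conj_transpose (A ** (X ** A)) = conj_transpose A"
    and "conj_transpose (X ** (A ** X)) = conj_transpose X"
    using assms by (simp_all add: is_moore_penrose_def matrix_mul_assoc)
  then have "conj_transpose A ** conj_transpose X ** conj_transpose A = conj_transpose A"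
    and "conj_transpose X ** conj_transpose A ** conj_transpose X = conj_transpose X"
    by (simp_all add: conj_transpose_mult)
  then show ?thesis
    using assms by (simp add: is_moore_penrose_def AX XA)
qed

text \<open>
  Both \<open>A X\<close> and \<open>A Y\<close> are the orthogonal projection onto the range of \<open>A\<close>: each acts as the identity
  on the other, and taking adjoints of a product of Hermitian matrices reverses it, so they coincide.
  The same holds for \<open>X A\<close> and \<open>Y A\<close>, and \<open>X = X A X\<close> is determined by these products.
\<close>

lemma is_moore_penrose_unique:
  assumes X: "is_moore_penrose A X" and Y: "is_moore_penrose A Y"
  shows "X = Y"
proof -
  have "A ** X = A ** Y ** (A ** X)"
    using Y by (simp add: is_moore_penrose_def matrix_mul_assoc)
  also have "\<dots> = conj_transpose (A ** X ** (A ** Y))"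
    using X Y by (simp add: is_moore_penrose_def conj_transpose_mult[of "A ** X"])
  also have "\<dots> = A ** Y"
    using X Y by (simp add: is_moore_penrose_def matrix_mul_assoc)
  finally have AX: "A ** X = A ** Y" .
  have "X ** A = X ** A ** (Y ** A)"
    using Y by (simp add: is_moore_penrose_def flip: matrix_mul_assoc)
  also have "\<dots> = conj_transpose (Y ** A ** (X ** A))"
    using X Y by (simp add: is_moore_penrose_def conj_transpose_mult[of "Y ** A"])
  also have "\<dots> = Y ** A"
    using X Y by (simp add: is_moore_penrose_def flip: matrix_mul_assoc)
  finally have XA: "X ** A = Y ** A" .
  have "X = X ** A ** X"
    using X by (simp add: is_moore_penrose_def)
  also have "\<dots> = Y ** A ** Y"
    by (metis AX XA matrix_mul_assoc)
  also have "\<dots> = Y"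
    using Y by (simp add: is_moore_penrose_def)
  finally show ?thesis .
qed

lemma is_moore_penrose_moore_penrose: "is_moore_penrose A (moore_penrose A)"
  unfolding moore_penrose_def
  by (rule theI'[OF ex_ex1I[OF exists_moore_penrose is_moore_penrose_unique]])

section \<open>Range spaces\<close>

lemma range_space_mult: "range_space (A ** B) = (*v) A ` range_space B"
  by (simp add: range_space_def image_image matrix_vector_mul_assoc)

lemma range_space_mult_subset: "range_space (A ** B) \<subseteq> range_space A"
  by (auto simp: range_space_mult) (auto simp: range_space_def)

text \<open>
  Since \<open>X A\<close> is Hermitian, \<open>X = (X A)\<^sup>* X\<close> starts with the factor \<open>A\<^sup>*\<close>, and
  \<open>A\<^sup>* = (A X A)\<^sup>* = X A A\<^sup>*\<close> starts with the factor \<open>X\<close>.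
\<close>

lemma range_space_moore_penrose:
  assumes "is_moore_penrose A X"
  shows "range_space X = range_space (conj_transpose A)"
proof
  have "X = conj_transpose (X ** A) ** X"
    using assms by (simp add: is_moore_penrose_def)
  also have "\<dots> = conj_transpose A ** (conj_transpose X ** X)"
    by (simp add: conj_transpose_mult matrix_mul_assoc)
  finally show "range_space X \<subseteq> range_space (conj_transpose A)"
    by (metis range_space_mult_subset)
  have "conj_transpose A = conj_transpose (A ** (X ** A))"
    using assms by (simp add: is_moore_penrose_def matrix_mul_assoc)
  also have "\<dots> = conj_transpose (X ** A) ** conj_transpose A"
    by (rule conj_transpose_mult)
  also have "\<dots> = X ** (A ** conj_transpose A)"
    using assms by (simp add: is_moore_penrose_def matrix_mul_assoc)
  finally show "range_space (conj_transpose A) \<subseteq> range_space X"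
    by (metis range_space_mult_subset)
qed

lemma partial_isometry_conj_transpose:
  assumes "partial_isometry S"
  shows "partial_isometry (conj_transpose S)"
proof -
  have "conj_transpose S = conj_transpose (S ** conj_transpose S ** S)"
    by (rule arg_cong[OF assms[unfolded partial_isometry_def]])
  also have "\<dots> = conj_transpose S ** conj_transpose (conj_transpose S) ** conj_transpose S"
    by (simp add: conj_transpose_mult matrix_mul_assoc)
  finally show ?thesis
    unfolding partial_isometry_def .
qed

lemma partial_isometry_fixes_range:
  assumes "partial_isometry S" "x \<in> range_space S"
  shows "S *v (conj_transpose S *v x) = x"
proof -
  have "S ** conj_transpose S ** S = S"
    using assms(1) unfolding partial_isometry_def by (rule sym)
  then show ?thesis
    using assms(2) by (auto simp: range_space_def matrix_vector_mul_assoc matrix_mul_assoc)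
qed

lemma range_space_subset_partial_isometry_iff:
  assumes "partial_isometry S"
  shows "range_space B \<subseteq> range_space S \<longleftrightarrow> S ** conj_transpose S ** B = B"
proof
  assume sub: "range_space B \<subseteq> range_space S"
  have "S *v (conj_transpose S *v (B *v x)) = B *v x" for x
    using sub by (intro partial_isometry_fixes_range[OF assms]) (auto simp: range_space_def)
  then show "S ** conj_transpose S ** B = B"
    by (simp add: matrix_eq flip: matrix_vector_mul_assoc)
next
  assume "S ** conj_transpose S ** B = B"
  then show "range_space B \<subseteq> range_space S"
    using range_space_mult_subset[of S "conj_transpose S ** B"] by (simp add: matrix_mul_assoc)
qed

section \<open>The \<open>S\<close>-EP property as a statement about two ranges\<close>

text \<open>
  Only the two ranges of \<open>B\<close> and \<open>B\<^sup>*\<close> occur on the right-hand side, so matrices that share both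
  ranges are \<open>S\<close>-EP together.
\<close>

lemma S_EP_iff_range_spaces:
  assumes S: "partial_isometry S"
  shows "S_EP S B \<longleftrightarrow>
    range_space B \<subseteq> range_space S \<and>
    range_space (conj_transpose B) \<subseteq> range_space (conj_transpose S) \<and>
    (*v) S ` range_space (conj_transpose B) = range_space B"
proof -
  have right: "B = B ** conj_transpose S ** S \<longleftrightarrow>
      range_space (conj_transpose B) \<subseteq> range_space (conj_transpose S)"
  proof -
    have "conj_transpose (B ** conj_transpose S ** S) =
        conj_transpose S ** conj_transpose (conj_transpose S) ** conj_transpose B"
      by (simp add: conj_transpose_mult matrix_mul_assoc)
    then show ?thesis
      unfolding range_space_subset_partial_isometry_iff[OF partial_isometry_conj_transpose[OF S]]
      by (metis conj_transpose_eq_iff)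
  qed
  have image: "range_space (S ** conj_transpose B ** S) = (*v) S ` range_space (conj_transpose B)"
    if "range_space B \<subseteq> range_space S"
  proof -
    have "S ** conj_transpose S ** B = B"
      using that range_space_subset_partial_isometry_iff[OF S] by blast
    from arg_cong[OF this, of conj_transpose]
    have "conj_transpose B ** S ** conj_transpose S = conj_transpose B"
      by (simp add: conj_transpose_mult matrix_mul_assoc)
    then have "range_space (conj_transpose B ** S) = range_space (conj_transpose B)"
      by (metis range_space_mult_subset subset_antisym)
    then show ?thesis
      using range_space_mult[of S "conj_transpose B ** S"] by (simp add: matrix_mul_assoc)
  qed
  have left: "range_space B \<subseteq> range_space S"
    if "range_space B = range_space (S ** conj_transpose B ** S)"
    using range_space_mult_subset[of S "conj_transpose B ** S"] that
    by (simp add: matrix_mul_assoc)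
  show ?thesis
    unfolding S_EP_def right using image left by blast
qed

text \<open>
  On \<open>R(S\<^sup>*)\<close> the product \<open>S\<^sup>* S\<close> is the identity, so \<open>S\<^sup>*\<close> undoes \<open>S\<close> there.
\<close>

lemma partial_isometry_image_conj_transpose:
  assumes S: "partial_isometry S" and V: "V \<subseteq> range_space (conj_transpose S)"
    and image: "(*v) S ` V = U"
  shows "(*v) (conj_transpose S) ` U = V"
proof -
  have "conj_transpose S *v (S *v x) = x" if "x \<in> V" for x
    using partial_isometry_fixes_range[OF partial_isometry_conj_transpose[OF S], of x] that V
    by auto
  then have "(\<lambda>x. conj_transpose S *v (S *v x)) ` V = V"
    by simp
  then show ?thesis
    unfolding image[symmetric] image_image .
qed

section \<open>Equivalence of the three EP properties\<close>

theorem theorem3p9: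
  fixes T A :: "complex^'n^'m"
  assumes "partial_isometry T"
  shows "(S_EP T A \<longleftrightarrow> S_EP (conj_transpose T) (conj_transpose A)) \<and>
         (S_EP (conj_transpose T) (conj_transpose A) \<longleftrightarrow>
            S_EP (conj_transpose T) (moore_penrose A))"
proof
  have T': "partial_isometry (conj_transpose T)"
    using assms by (rule partial_isometry_conj_transpose)
  let ?X = "moore_penrose A"
  have X: "is_moore_penrose A ?X"
    by (rule is_moore_penrose_moore_penrose)
  show "S_EP T A \<longleftrightarrow> S_EP (conj_transpose T) (conj_transpose A)"
    unfolding S_EP_iff_range_spaces[OF assms] S_EP_iff_range_spaces[OF T']
      conj_transpose_conj_transpose
    using partial_isometry_image_conj_transpose[OF assms,
        of "range_space (conj_transpose A)" "range_space A"]
      partial_isometry_image_conj_transpose[OF T',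
        of "range_space A" "range_space (conj_transpose A)"]
    unfolding conj_transpose_conj_transpose by satx
  have "range_space ?X = range_space (conj_transpose A)"
    using X by (rule range_space_moore_penrose)
  moreover have "range_space (conj_transpose ?X) = range_space A"
    using range_space_moore_penrose[OF is_moore_penrose_conj_transpose[OF X]] by simp
  ultimately show "S_EP (conj_transpose T) (conj_transpose A) \<longleftrightarrow> S_EP (conj_transpose T) ?X"
    unfolding S_EP_iff_range_spaces[OF T'] by simp
qed

end
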